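(* Let $f:I\subseteq\mathbb{R}\to\mathbb{R}$ be a differentiable mapping on $I^{\circ}$ such that $f'\in L[a,b]$, where $a,b\in I^{\circ}$ with $a<b$, and let $\alpha,\lambda\in[0,1]$. If $|f'|^{q}$ is a $P$-function on $[a,b]$, $q>1$, then $$|I_{f}(\lambda,\alpha,a,b)|\leq (b-a)\left(\frac{1}{p+1}\right)^{\frac1p}\times\begin{cases}\varepsilon_{1}^{1/p}(\alpha,\lambda,p)\,c_{f}^{1/q}(\alpha,q)+\varepsilon_{1}^{1/p}(1-\alpha,\lambda,p)\,k_{f}^{1/q}(\alpha,q), & \alpha\lambda\leq 1-\alpha\leq 1-\lambda(1-\alpha),\\ \varepsilon_{1}^{1/p}(\alpha,\lambda,p)\,c_{f}^{1/q}(\alpha,q)+\varepsilon_{2}^{1/p}(1-\alpha,\lambda,p)\,k_{f}^{1/q}(\alpha,q), & \alpha\lambda\leq 1-\lambda(1-\alpha)\leq 1-\alpha,\\ \varepsilon_{2}^{1/p}(\alpha,\lambda,p)\,c_{f}^{1/q}(\alpha,q)+\varepsilon_{1}^{1/p}(1-\alpha,\lambda,p)\,k_{f}^{1/q}(\alpha,q), & 1-\alpha\leq\alpha\lambda\leq 1-\lambda(1-\alpha),\end{cases}$$ where $$c_{f}(\alpha,q)=(1-\alpha)\left[|f'((1-\alpha)b+\alpha a)|^{q}+|f'(a)|^{q}\right],\qquad k_{f}(\alpha,q)=\alpha\left[|f'((1-\alpha)b+\alpha a)|^{q}+|f'(b)|^{q}\right],$$ $$\varepsilon_{1}(\alpha,\lambda,p)=(\alpha\lambda)^{p+1}+(1-\alpha-\alpha\lambda)^{p+1},\qquad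 \varepsilon_{2}(\alpha,\lambda,p)=(\alpha\lambda)^{p+1}-(\alpha\lambda-1+\alpha)^{p+1},$$ and $\frac1p+\frac1q=1$.
   Context: $I$ is an interval of real numbers and $I^{\circ}$ is its interior. $L[a,b]$ denotes the integrable functions on $[a,b]$. A function $g:J\to\mathbb{R}$ on an interval $J$ is a $P$-function if $g$ is non-negative and $g(tx+(1-t)y)\leq g(x)+g(y)$ for all $x,y\in J$ and $t\in[0,1]$. For $a<b$ in $I^{\circ}$ and $\alpha,\lambda\in[0,1]$, $$I_{f}(\lambda,\alpha,a,b)=\lambda\left(\alpha f(a)+(1-\alpha)f(b)\right)+(1-\lambda)f(\alpha a+(1-\alpha)b)-\frac{1}{b-a}\int_{a}^{b}f(x)\,dx.$$ Notation such as $\varepsilon_1^{1/p}(\alpha,\lambda,p)$ means $(\varepsilon_1(\alpha,\lambda,p))^{1/p}$, and similarly for $c_f^{1/q}$, $k_f^{1/q}$, $\varepsilon_2^{1/p}$. *)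

theory Defs
  imports "HOL-Analysis.Analysis"
begin

definition P_function_on :: "real set \<Rightarrow> (real \<Rightarrow> real) \<Rightarrow> bool" where
  "P_function_on J g \<longleftrightarrow>
     is_interval J \<and> (\<forall>x\<in>J. 0 \<le> g x) \<and>
     (\<forall>x\<in>J. \<forall>y\<in>J. \<forall>t\<in>{0..1}. g (t * x + (1 - t) * y) \<le> g x + g y)"

definition I_fun :: "(real \<Rightarrow> real) \<Rightarrow> real \<Rightarrow> real \<Rightarrow> real \<Rightarrow> real \<Rightarrow> real" where
  "I_fun f l \<alpha> a b =
     l * (\<alpha> * f a + (1 - \<alpha>) * f b) + (1 - l) * f (\<alpha> * a + (1 - \<alpha>) * b)
     - 1 / (b - a) * integral {a..b} f"

(* The endpoints a, b, implicit in the usual notation c_f(alpha,q) and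
   k_f(alpha,q), are explicit arguments here. *)

definition c_fun :: "(real \<Rightarrow> real) \<Rightarrow> real \<Rightarrow> real \<Rightarrow> real \<Rightarrow> real \<Rightarrow> real" where
  "c_fun f a b \<alpha> q =
     (1 - \<alpha>) * (\<bar>deriv f ((1 - \<alpha>) * b + \<alpha> * a)\<bar> powr q + \<bar>deriv f a\<bar> powr q)"

definition k_fun :: "(real \<Rightarrow> real) \<Rightarrow> real \<Rightarrow> real \<Rightarrow> real \<Rightarrow> real \<Rightarrow> real" where
  "k_fun f a b \<alpha> q =
     \<alpha> * (\<bar>deriv f ((1 - \<alpha>) * b + \<alpha> * a)\<bar> powr q + \<bar>deriv f b\<bar> powr q)"

(* Real exponents are rendered by powr. In eps1 and eps2 the bases are non-negative
   exactly in the cases in which these functions are used, for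
   (alpha, l) as well as for (1 - alpha, l). *)

definition eps1 :: "real \<Rightarrow> real \<Rightarrow> real \<Rightarrow> real" where
  "eps1 \<alpha> l p = (\<alpha> * l) powr (p + 1) + (1 - \<alpha> - \<alpha> * l) powr (p + 1)"

definition eps2 :: "real \<Rightarrow> real \<Rightarrow> real \<Rightarrow> real" where
  "eps2 \<alpha> l p = (\<alpha> * l) powr (p + 1) - (\<alpha> * l - 1 + \<alpha>) powr (p + 1)"

end

theory Submission imports Defs begin

text \<open>
  Put \<open>g t = f (a + t * (b - a))\<close>, so that the point \<open>\<alpha> * a + (1 - \<alpha>) * b\<close> is the image of
  \<open>t = 1 - \<alpha>\<close>, and split the unit interval there.  Integrating \<open>(t - m) * g' t\<close> by parts over
  \<open>{0..1 - \<alpha>}\<close> with \<open>m = \<alpha> * l\<close> produces the terms of \<open>I_fun\<close> that belong to the endpoint \<open>a\<close>.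
  The same computation from the other end, over a length \<open>\<alpha>\<close> with \<open>m = l * (1 - \<alpha>)\<close>, produces
  those that belong to \<open>b\<close>; the two boundary contributions at the splitting point add up to the
  weight \<open>1 - l\<close>.  Since the second part is the first one under the reflection exchanging \<open>a\<close>
  with \<open>b\<close> and \<open>\<alpha>\<close> with \<open>1 - \<alpha>\<close>, a single estimate (\<open>endpoint_estimate\<close>) serves both.

  On each part a \<open>P\<close>-function is bounded by the sum of its values at the two endpoints
  (\<open>P_function_on_segment_bound\<close>).  So \<open>\<bar>f'\<bar>\<close> is bounded there by the \<open>q\<close>-th root of that sum,
  and only \<open>\<integral>\<bar>t - m\<bar>\<close> remains.  Hoelder's inequality against the constant function \<open>1\<close>
  (\<open>integral_le_power_mean\<close>) replaces it by
  \<open>(\<integral>\<bar>t - m\<bar> powr p) powr (1/p) * h powr (1/q)\<close>, with \<open>h\<close> the length of the part; the factor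
  \<open>h powr (1/q)\<close> accounts for the weight \<open>1 - \<alpha>\<close> or \<open>\<alpha>\<close> in \<open>c_fun\<close> and \<open>k_fun\<close>, and the integral is
  explicit.  Its value depends on whether \<open>m\<close> lies inside or beyond the part: the first
  alternative gives \<open>eps1\<close>, the second \<open>eps2\<close>.
\<close>

section \<open>Integrals of the kernel\<close>

text \<open>
  The kernel \<open>t - m\<close> may change sign inside the interval.  The signed primitive
  \<open>(t - m) * \<bar>t - m\<bar> powr p / (p + 1)\<close> covers both sides at once, which spares a case distinction
  on the position of \<open>m\<close>.
\<close>
lemma has_integral_abs_diff_powr:
  fixes m h p :: real
  assumes "0 \<le> h" "0 \<le> m" "0 < p"
  shows "((\<lambda>t. \<bar>t - m\<bar> powr p) has_integral
           ((m * m powr p + (h - m) * \<bar>h - m\<bar> powr p) / (p + 1))) {0..h}"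
proof -
  define G where "G t = (t - m) * \<bar>t - m\<bar> powr p / (p + 1)" for t
  have "((\<lambda>t. \<bar>t - m\<bar> powr p) has_integral (G h - G 0)) {0..h}"
  proof (rule fundamental_theorem_of_calculus_interior_strong)
    show "finite {m}" "0 \<le> h" using assms by auto
    show "continuous_on {0..h} G"
      unfolding G_def using assms by (intro continuous_on_powr' continuous_intros) auto
    show "(G has_vector_derivative \<bar>t - m\<bar> powr p) (at t)" if t: "t \<in> {0<..<h} - {m}" for t
    proof (cases "t > m")
      case True
      have "((\<lambda>t. (t - m) powr (p + 1) / (p + 1)) has_real_derivative (t - m) powr p) (at t)"
        using True assms by (auto intro!: derivative_eq_intros simp: powr_diff)
      moreover have "\<forall>\<^sub>F s in nhds t. m < s"
        using eventually_nhds_in_open[of "{m<..}" t] True by simp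
      then have "\<forall>\<^sub>F s in nhds t. (s - m) powr (p + 1) / (p + 1) = G s"
        by eventually_elim (simp add: G_def powr_add)
      ultimately have "(G has_real_derivative (t - m) powr p) (at t)"
        by (simp add: DERIV_cong_ev)
      then show ?thesis
        using True by (simp add: has_real_derivative_iff_has_vector_derivative)
    next
      case False
      then have lt: "t < m" using t by auto
      have "((\<lambda>t. - ((m - t) powr (p + 1) / (p + 1))) has_real_derivative (m - t) powr p) (at t)"
        using lt assms by (auto intro!: derivative_eq_intros simp: powr_diff)
      moreover have "\<forall>\<^sub>F s in nhds t. s < m"
        using eventually_nhds_in_open[of "{..<m}" t] lt by simp
      then have "\<forall>\<^sub>F s in nhds t. - ((m - s) powr (p + 1) / (p + 1)) = G s"
        by eventually_elim
           (simp add: G_def powr_add minus_divide_left left_diff_distrib right_diff_distrib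
              mult.commute)
      ultimately have "(G has_real_derivative (m - t) powr p) (at t)"
        by (simp add: DERIV_cong_ev)
      then show ?thesis
        using lt by (simp add: has_real_derivative_iff_has_vector_derivative)
    qed
  qed
  moreover have "G h - G 0 = (m * m powr p + (h - m) * \<bar>h - m\<bar> powr p) / (p + 1)"
    using assms by (simp add: G_def add_divide_distrib)
  ultimately show ?thesis by simp
qed

text \<open>
  Hoelder's inequality against the constant \<open>1\<close>.  Young's inequality for \<open>u x / A\<close> and \<open>1\<close>,
  integrated, bounds the integral by an expression in \<open>A > 0\<close>; the choice
  \<open>A = (J / (d - c)) powr (1 / p)\<close>, the mean of order \<open>p\<close>, minimises it.
\<close>
lemma integral_le_power_mean:
  fixes u :: "real \<Rightarrow> real" and c d p q J U :: real
  assumes pq: "p > 1" "q > 1" "1 / p + 1 / q = 1" and "c \<le> d"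
    and u: "(u has_integral U) {c..d}" "\<And>x. x \<in> {c..d} \<Longrightarrow> 0 \<le> u x"
    and J: "((\<lambda>x. u x powr p) has_integral J) {c..d}"
  shows "U \<le> J powr (1 / p) * (d - c) powr (1 / q)"
proof (cases "c = d")
  case True
  then have "U = 0"
    by (intro has_integral_unique[OF u(1)] has_integral_null_real) simp
  with True show ?thesis by simp
next
  case False
  define h where "h = d - c"
  have h: "h > 0" using False assms by (simp add: h_def)
  have young: "U \<le> J * A powr (1 - p) / p + A * h / q" if A: "A > 0" for A
  proof (rule has_integral_le[OF u(1)])
    have "((\<lambda>x. u x powr p * (A powr (1 - p) / p) + A / q) has_integral
            (J * (A powr (1 - p) / p) + h * (A / q))) {c..d}"
      using has_integral_add[OF has_integral_mult_left[OF J, of "A powr (1 - p) / p"]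
            has_integral_const_real[of "A / q" c d]]
        \<open>c \<le> d\<close> by (simp add: h_def)
    then show "((\<lambda>x. u x powr p * (A powr (1 - p) / p) + A / q) has_integral
            (J * A powr (1 - p) / p + A * h / q)) {c..d}"
      by (simp add: mult.commute)
    show "u x \<le> u x powr p * (A powr (1 - p) / p) + A / q" if "x \<in> {c..d}" for x
    proof -
      have "u x / A * 1 \<le> (u x / A) powr p / p + 1 powr q / q"
        using pq A u(2)[OF that] by (intro Youngs_inequality) auto
      then have "A * (u x / A) \<le> A * ((u x / A) powr p / p + 1 / q)"
        using A by (intro mult_left_mono) auto
      also have "A * ((u x / A) powr p / p + 1 / q) = u x powr p * (A powr (1 - p) / p) + A / q"
        using A u(2)[OF that] by (simp add: powr_divide powr_diff algebra_simps)
      finally show ?thesis using A by simp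
    qed
  qed
  have "J \<ge> 0" using has_integral_nonneg[OF J] by simp
  show ?thesis
  proof (cases "J = 0")
    case True
    \<comment> \<open>The mean of order \<open>p\<close> is now \<open>0\<close>, so \<open>A\<close> tends to it instead of attaining it.\<close>
    have "U \<le> 0 + e" if "e > 0" for e
      using young[of "e * q / h"] that pq h True by simp
    then have "U \<le> 0" by (rule field_le_epsilon)
    then show ?thesis using True by simp
  next
    case False
    with \<open>J \<ge> 0\<close> have J0: "J > 0" by simp
    define A where "A = (J / h) powr (1 / p)"
    have A: "A > 0" using J0 h by (simp add: A_def)
    have q: "1 / q = 1 - 1 / p" using pq by simp
    have Ah: "A * h = J powr (1 / p) * h powr (1 / q)"
      using J0 h by (simp add: A_def q powr_divide powr_diff)
    have "A powr p = J / h" using J0 h pq by (simp add: A_def powr_powr)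
    then have "J * A powr (1 - p) = A * h"
      using J0 h A by (simp add: powr_diff field_simps)
    then have "U \<le> A * h * (1 / p + 1 / q)"
      using young[OF A] by (simp add: algebra_simps)
    then show ?thesis using pq Ah by (simp add: h_def)
  qed
qed

section \<open>Estimates on one part of the interval\<close>

lemma P_function_on_segment_bound:
  assumes "P_function_on J g" "x \<in> J" "y \<in> J" "z \<in> closed_segment x y"
  shows "g z \<le> g x + g y"
proof -
  from assms(4) obtain t where "t \<in> {0..1}" "z = (1 - t) * x + t * y"
    by (auto simp: closed_segment_def)
  then show ?thesis
    using assms(1-3) unfolding P_function_on_def by (metis add.commute)
qed

text \<open>
  The boundary terms \<open>(h - m) * g h + m * g 0\<close> are those of the integration by parts of
  \<open>(t - m) * g' t\<close>.  As \<open>(t - m) * g t\<close> is differentiable everywhere, its derivative has a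
  gauge integral, and subtracting the continuous function \<open>g\<close> leaves the integral of
  \<open>(t - m) * g' t\<close>.
\<close>
lemma weighted_boundary_minus_integral_bound:
  fixes g g' :: "real \<Rightarrow> real"
  assumes "0 \<le> h"
    and der: "\<And>t. t \<in> {0..h} \<Longrightarrow> (g has_real_derivative g' t) (at t)"
    and bound: "\<And>t. t \<in> {0..h} \<Longrightarrow> \<bar>g' t\<bar> \<le> M"
    and int: "((\<lambda>t. \<bar>t - m\<bar>) has_integral U) {0..h}"
  shows "\<bar>(h - m) * g h + m * g 0 - integral {0..h} g\<bar> \<le> M * U"
proof -
  have "((\<lambda>t. g t + (t - m) * g' t) has_integral ((h - m) * g h - (0 - m) * g 0)) {0..h}"
  proof (rule fundamental_theorem_of_calculus[OF \<open>0 \<le> h\<close>])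
    fix t assume "t \<in> {0..h}"
    then have "((\<lambda>t. (t - m) * g t) has_real_derivative g t + (t - m) * g' t) (at t)"
      by (auto intro!: derivative_eq_intros der)
    then show "((\<lambda>t. (t - m) * g t) has_vector_derivative g t + (t - m) * g' t)
                 (at t within {0..h})"
      by (simp add: has_real_derivative_iff_has_vector_derivative has_vector_derivative_at_within)
  qed
  moreover have "continuous_on {0..h} g"
    using der by (meson DERIV_isCont continuous_at_imp_continuous_on)
  then have "(g has_integral integral {0..h} g) {0..h}"
    using integrable_continuous_real integrable_integral by blast
  ultimately have "((\<lambda>t. (g t + (t - m) * g' t) - g t) has_integral
      ((h - m) * g h - (0 - m) * g 0) - integral {0..h} g) {0..h}"
    by (rule has_integral_diff)
  then have parts: "((\<lambda>t. (t - m) * g' t) has_integral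
      ((h - m) * g h + m * g 0 - integral {0..h} g)) {0..h}"
    by simp
  have "norm (integral {0..h} (\<lambda>t. (t - m) * g' t)) \<le> integral {0..h} (\<lambda>t. M * \<bar>t - m\<bar>)"
  proof (rule integral_norm_bound_integral)
    show "norm ((t - m) * g' t) \<le> M * \<bar>t - m\<bar>" if "t \<in> {0..h}" for t
      using mult_right_mono[OF bound[OF that], of "\<bar>t - m\<bar>"] by (simp add: abs_mult mult.commute)
  qed (use parts has_integral_mult_right[OF int, of M] in auto)
  then show ?thesis
    using integral_unique[OF parts] integral_unique[OF int] by simp
qed

text \<open>
  Integration by parts and Hoelder's inequality combined.  The derivative is controlled through
  \<open>\<bar>g' t\<bar> powr q\<close>, because that is the quantity to which a \<open>P\<close>-function bound applies; the factor
  \<open>D\<close> is split off for the length that enters when \<open>g\<close> is an affine reparametrisation.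
\<close>
lemma half_interval_estimate:
  fixes g g' :: "real \<Rightarrow> real" and h m p q S :: real
  assumes pq: "p > 1" "q > 1" "1 / p + 1 / q = 1" and "0 \<le> h" "0 \<le> m"
    and der: "\<And>t. t \<in> {0..h} \<Longrightarrow> (g has_real_derivative D * g' t) (at t)"
    and "0 \<le> D"
    and bound: "\<And>t. t \<in> {0..h} \<Longrightarrow> \<bar>g' t\<bar> powr q \<le> S"
  shows "\<bar>(h - m) * g h + m * g 0 - integral {0..h} g\<bar>
      \<le> D * (1 / (p + 1)) powr (1 / p) *
          ((m * m powr p + (h - m) * \<bar>h - m\<bar> powr p) powr (1 / p) * (h * S) powr (1 / q))"
proof -
  define K where "K = m * m powr p + (h - m) * \<bar>h - m\<bar> powr p"
  define U where "U = integral {0..h} (\<lambda>t. \<bar>t - m\<bar>)"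
  have J: "((\<lambda>t. \<bar>t - m\<bar> powr p) has_integral (K / (p + 1))) {0..h}"
    unfolding K_def using assms by (intro has_integral_abs_diff_powr) auto
  have U: "((\<lambda>t. \<bar>t - m\<bar>) has_integral U) {0..h}"
    unfolding U_def by (intro integrable_integral integrable_continuous_real continuous_intros)
  have "S \<ge> 0" using bound[of 0] \<open>0 \<le> h\<close> powr_ge_zero[of "\<bar>g' 0\<bar>" q] by (auto simp del: powr_ge_zero)
  have "K \<ge> 0" using has_integral_nonneg[OF J] pq by (simp add: zero_le_divide_iff)
  have "\<bar>D * g' t\<bar> \<le> D * S powr (1 / q)" if "t \<in> {0..h}" for t
  proof -
    have "\<bar>g' t\<bar> = (\<bar>g' t\<bar> powr q) powr (1 / q)" using pq by (simp add: powr_powr)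
    also have "\<dots> \<le> S powr (1 / q)"
      using bound[OF that] pq by (intro powr_mono2) auto
    finally show ?thesis using \<open>0 \<le> D\<close> by (simp add: abs_mult mult_left_mono)
  qed
  then have "\<bar>(h - m) * g h + m * g 0 - integral {0..h} g\<bar> \<le> (D * S powr (1 / q)) * U"
    using weighted_boundary_minus_integral_bound[OF \<open>0 \<le> h\<close> der _ U] by blast
  also have "U \<le> (K / (p + 1)) powr (1 / p) * (h - 0) powr (1 / q)"
    by (rule integral_le_power_mean[OF pq \<open>0 \<le> h\<close> U _ J]) auto
  then have "(D * S powr (1 / q)) * U
      \<le> (D * S powr (1 / q)) * ((K / (p + 1)) powr (1 / p) * (h - 0) powr (1 / q))"
    using \<open>0 \<le> D\<close> by (intro mult_left_mono) auto
  also have "\<dots> = D * (1 / (p + 1)) powr (1 / p) * (K powr (1 / p) * (h * S) powr (1 / q))"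
    using \<open>S \<ge> 0\<close> \<open>K \<ge> 0\<close> \<open>0 \<le> h\<close> pq by (simp add: powr_mult powr_divide)
  finally show ?thesis unfolding K_def .
qed

text \<open>Stated for \<open>s\<close> of either sign, so that it also parametrises an interval from its right end.\<close>
lemma integral_affine_reparametrisation:
  fixes f :: "real \<Rightarrow> real"
  assumes "s \<noteq> 0" "0 \<le> h" "f integrable_on closed_segment e (e + s * h)"
  shows "integral {0..h} (\<lambda>t. f (e + s * t)) =
           integral (closed_segment e (e + s * h)) f / \<bar>s\<bar>"
proof -
  define lo hi where "lo = min e (e + s * h)" and "hi = max e (e + s * h)"
  have seg: "closed_segment e (e + s * h) = {lo..hi}"
    by (simp add: lo_def hi_def closed_segment_eq_real_ivl min_def max_def)
  have "(f has_integral integral {lo..hi} f) (cbox lo hi)"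
    using assms(3) seg by (simp add: integrable_integral)
  from has_integral_affinity[OF this \<open>s \<noteq> 0\<close>, of e]
  have "((\<lambda>t. f (e + s * t)) has_integral integral {lo..hi} f / \<bar>s\<bar>)
      ((\<lambda>x. (1 / s) *\<^sub>R x + - ((1 / s) *\<^sub>R e)) ` {lo..hi})"
    by (simp add: add.commute)
  moreover have "(\<lambda>x. (1 / s) *\<^sub>R x + - ((1 / s) *\<^sub>R e)) ` {lo..hi} = {0..h}"
  proof (rule set_eqI)
    fix t
    have "t \<in> (\<lambda>x. (1 / s) *\<^sub>R x + - ((1 / s) *\<^sub>R e)) ` {lo..hi} \<longleftrightarrow> e + s * t \<in> {lo..hi}"
    proof
      assume "e + s * t \<in> {lo..hi}"
      then show "t \<in> (\<lambda>x. (1 / s) *\<^sub>R x + - ((1 / s) *\<^sub>R e)) ` {lo..hi}"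
        using \<open>s \<noteq> 0\<close> by (intro image_eqI[of _ _ "e + s * t"]) (auto simp: field_simps)
    qed (use \<open>s \<noteq> 0\<close> in \<open>auto simp: field_simps\<close>)
    also have "\<dots> \<longleftrightarrow> t \<in> {0..h}"
    proof (cases "s > 0")
      case True
      then show ?thesis using \<open>0 \<le> h\<close> by (auto simp: lo_def hi_def min_def max_def zero_le_mult_iff)
    next
      case False
      then have "s < 0" using \<open>s \<noteq> 0\<close> by simp
      then have "s * h \<le> 0" using \<open>0 \<le> h\<close> by (simp add: mult_le_0_iff)
      then have "lo = e + s * h" "hi = e" by (simp_all add: lo_def hi_def)
      with \<open>s < 0\<close> show ?thesis by (auto simp: mult_le_0_iff)
    qed
    finally show "t \<in> (\<lambda>x. (1 / s) *\<^sub>R x + - ((1 / s) *\<^sub>R e)) ` {lo..hi} \<longleftrightarrow> t \<in> {0..h}" .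
  qed
  ultimately show ?thesis using seg by (simp add: integral_unique)
qed

text \<open>
  The estimate of one part in the original variable: the part starts at the endpoint \<open>e\<close> of the
  whole interval and ends at \<open>e + s * h\<close>, where \<open>s = b - a\<close> for \<open>e = a\<close> and \<open>s = a - b\<close> for
  \<open>e = b\<close>.
\<close>
lemma endpoint_estimate:
  fixes f f' :: "real \<Rightarrow> real" and e s h m p q :: real
  assumes pq: "p > 1" "q > 1" "1 / p + 1 / q = 1" and "0 \<le> h" "0 \<le> m" "s \<noteq> 0"
    and der: "\<And>x. x \<in> closed_segment e (e + s * h) \<Longrightarrow> (f has_real_derivative f' x) (at x)"
    and P: "P_function_on J (\<lambda>x. \<bar>f' x\<bar> powr q)" "e \<in> J" "e + s * h \<in> J"
  shows "\<bar>(h - m) * f (e + s * h) + m * f e - integral (closed_segment e (e + s * h)) f / \<bar>s\<bar>\<bar>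
      \<le> \<bar>s\<bar> * (1 / (p + 1)) powr (1 / p) *
          ((m * m powr p + (h - m) * \<bar>h - m\<bar> powr p) powr (1 / p) *
           (h * (\<bar>f' (e + s * h)\<bar> powr q + \<bar>f' e\<bar> powr q)) powr (1 / q))"
proof -
  have seg: "e + s * t \<in> closed_segment e (e + s * h)" if "t \<in> {0..h}" for t
  proof (cases "h = 0")
    case False
    have "e + s * t = (1 - t / h) *\<^sub>R e + (t / h) *\<^sub>R (e + s * h)"
      using False by (simp add: field_simps)
    moreover have "0 \<le> t / h" "t / h \<le> 1" using that False by auto
    ultimately show ?thesis unfolding closed_segment_def by blast
  qed (use that in auto)
  have "continuous_on (closed_segment e (e + s * h)) f"
    using der by (meson DERIV_isCont continuous_at_imp_continuous_on)
  then have int: "f integrable_on closed_segment e (e + s * h)"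
    by (auto simp: closed_segment_eq_real_ivl intro: integrable_continuous_real)
  define g where "g t = f (e + s * t)" for t
  have g: "(g has_real_derivative \<bar>s\<bar> * (sgn s * f' (e + s * t))) (at t)" if "t \<in> {0..h}" for t
  proof -
    have "(g has_real_derivative f' (e + s * t) * s) (at t)"
      unfolding g_def
      by (rule DERIV_chain2[where f = f and g = "\<lambda>t. e + s * t", OF der[OF seg[OF that]]])
         (auto intro!: derivative_eq_intros)
    then show ?thesis by (simp add: mult.commute mult.assoc [symmetric] abs_mult_sgn)
  qed
  have "\<bar>sgn s * f' (e + s * t)\<bar> powr q \<le> \<bar>f' (e + s * h)\<bar> powr q + \<bar>f' e\<bar> powr q"
    if "t \<in> {0..h}" for t
    using P_function_on_segment_bound[OF P seg[OF that]] \<open>s \<noteq> 0\<close>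
    by (simp add: abs_mult abs_sgn_eq)
  from half_interval_estimate[OF pq \<open>0 \<le> h\<close> \<open>0 \<le> m\<close> g _ this]
  show ?thesis
    using integral_affine_reparametrisation[OF \<open>s \<noteq> 0\<close> \<open>0 \<le> h\<close> int]
    by (simp add: g_def[abs_def])
qed

section \<open>The inequality\<close>

text \<open>
  With \<open>h = 1 - x\<close> and \<open>m = x * l\<close>, the value of the kernel integral specialises to \<open>eps1\<close> or
  \<open>eps2\<close> according to the sign of \<open>h - m\<close>.
\<close>
lemma kernel_value_eq_eps1:
  assumes "0 \<le> x * l" "x * l \<le> 1 - x"
  shows "x * l * (x * l) powr p + (1 - x - x * l) * \<bar>1 - x - x * l\<bar> powr p = eps1 x l p"
  using assms by (simp add: eps1_def powr_add mult.commute)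

lemma kernel_value_eq_eps2:
  assumes "0 \<le> x * l" "1 - x \<le> x * l"
  shows "x * l * (x * l) powr p + (1 - x - x * l) * \<bar>1 - x - x * l\<bar> powr p = eps2 x l p"
proof -
  have "\<bar>1 - x - x * l\<bar> = x * l - 1 + x" using assms by simp
  moreover have "(x * l - 1 + x) powr (p + 1) = (x * l - 1 + x) * (x * l - 1 + x) powr p"
    using assms by (simp add: powr_add)
  moreover have "(x * l) powr (p + 1) = x * l * (x * l) powr p"
    using assms by (simp add: powr_add)
  ultimately show ?thesis by (simp add: eps2_def algebra_simps)
qed

theorem theorem3:
  fixes f :: "real \<Rightarrow> real" and I :: "real set" and a b \<alpha> l p q :: real
  assumes "is_interval I"
    and "f differentiable_on interior I"
    and "a \<in> interior I" and "b \<in> interior I" and "a < b"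
    and "deriv f absolutely_integrable_on {a..b}"
    and "\<alpha> \<in> {0..1}" and "l \<in> {0..1}"
    and "q > 1" and "1 / p + 1 / q = 1"
    and "P_function_on {a..b} (\<lambda>x. \<bar>deriv f x\<bar> powr q)"
  shows
    "(\<alpha> * l \<le> 1 - \<alpha> \<and> 1 - \<alpha> \<le> 1 - l * (1 - \<alpha>) \<longrightarrow>
        \<bar>I_fun f l \<alpha> a b\<bar> \<le> (b - a) * (1 / (p + 1)) powr (1 / p) *
          (eps1 \<alpha> l p powr (1 / p) * c_fun f a b \<alpha> q powr (1 / q)
           + eps1 (1 - \<alpha>) l p powr (1 / p) * k_fun f a b \<alpha> q powr (1 / q)))
     \<and> (\<alpha> * l \<le> 1 - l * (1 - \<alpha>) \<and> 1 - l * (1 - \<alpha>) \<le> 1 - \<alpha> \<longrightarrow>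
        \<bar>I_fun f l \<alpha> a b\<bar> \<le> (b - a) * (1 / (p + 1)) powr (1 / p) *
          (eps1 \<alpha> l p powr (1 / p) * c_fun f a b \<alpha> q powr (1 / q)
           + eps2 (1 - \<alpha>) l p powr (1 / p) * k_fun f a b \<alpha> q powr (1 / q)))
     \<and> (1 - \<alpha> \<le> \<alpha> * l \<and> \<alpha> * l \<le> 1 - l * (1 - \<alpha>) \<longrightarrow>
        \<bar>I_fun f l \<alpha> a b\<bar> \<le> (b - a) * (1 / (p + 1)) powr (1 / p) *
          (eps2 \<alpha> l p powr (1 / p) * c_fun f a b \<alpha> q powr (1 / q)
           + eps1 (1 - \<alpha>) l p powr (1 / p) * k_fun f a b \<alpha> q powr (1 / q)))"
proof -
  define c where "c = \<alpha> * a + (1 - \<alpha>) * b"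
  define C where "C = (b - a) * (1 / (p + 1)) powr (1 / p)"
  define K where
    "K x = x * l * (x * l) powr p + (1 - x - x * l) * \<bar>1 - x - x * l\<bar> powr p" for x
  have \<alpha>: "0 \<le> \<alpha>" "\<alpha> \<le> 1" and l: "0 \<le> l" "l \<le> 1" using assms by auto
  have "0 < 1 / q" "1 / q < 1" using \<open>q > 1\<close> by auto
  then have "0 < 1 / p" "1 / p < 1" using \<open>1 / p + 1 / q = 1\<close> by linarith+
  then have "p > 1" by (simp add: divide_less_eq_1)
  note pq = \<open>p > 1\<close> \<open>q > 1\<close> \<open>1 / p + 1 / q = 1\<close>
  have "is_interval (interior I)"
    using \<open>is_interval I\<close> by (simp add: is_interval_convex_1 convex_interior)
  then have sub: "{a..b} \<subseteq> interior I"
    using \<open>a \<in> interior I\<close> \<open>b \<in> interior I\<close>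
    by (meson atLeastAtMost_iff mem_is_interval_1_I subsetI)
  have der: "(f has_real_derivative deriv f x) (at x)" if "x \<in> {a..b}" for x
  proof -
    have "f differentiable at x"
      using that sub \<open>f differentiable_on interior I\<close>
      by (metis differentiable_on_eq_differentiable_at open_interior subsetD)
    then show ?thesis by (simp add: DERIV_deriv_iff_real_differentiable)
  qed
  have ca: "c = a + (b - a) * (1 - \<alpha>)" and cb: "c = b + (a - b) * \<alpha>"
    by (simp_all add: c_def algebra_simps)
  have "a \<le> c" using \<alpha> \<open>a < b\<close> by (simp add: ca)
  moreover have "c \<le> b" using \<alpha> \<open>a < b\<close> by (simp add: cb mult_nonpos_nonneg)
  ultimately have cs: "a \<le> c" "c \<le> b" .
  have seg_a: "closed_segment a c = {a..c}" and seg_b: "closed_segment b c = {c..b}"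
    using cs by (auto simp: closed_segment_eq_real_ivl)
  have "continuous_on {a..b} f"
    using der by (meson DERIV_isCont continuous_at_imp_continuous_on)
  then have split: "integral {a..b} f = integral {a..c} f + integral {c..b} f"
    using Henstock_Kurzweil_Integration.integral_combine[of a c b f] cs
      integrable_continuous_real by metis
  \<comment> \<open>The coefficients of \<open>f c\<close> in \<open>A\<close> and \<open>B\<close> add up to \<open>1 - l\<close>.\<close>
  define A where
    "A = (1 - \<alpha> - \<alpha> * l) * f c + \<alpha> * l * f a - integral {a..c} f / (b - a)"
  define B where
    "B = (\<alpha> - (1 - \<alpha>) * l) * f c + (1 - \<alpha>) * l * f b - integral {c..b} f / (b - a)"
  have c': "c = (1 - \<alpha>) * b + \<alpha> * a" by (simp add: c_def)
  have bound_A: "\<bar>A\<bar> \<le> C * (K \<alpha> powr (1 / p) * c_fun f a b \<alpha> q powr (1 / q))"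
    unfolding A_def C_def K_def c_fun_def
    using endpoint_estimate[OF pq, of "1 - \<alpha>" "\<alpha> * l" "b - a" a f "deriv f" "{a..b}",
        folded ca, unfolded seg_a] der assms(5,11) cs \<alpha> l
    by (simp flip: c')
  have bound_B: "\<bar>B\<bar> \<le> C * (K (1 - \<alpha>) powr (1 / p) * k_fun f a b \<alpha> q powr (1 / q))"
    unfolding B_def C_def K_def k_fun_def
    using endpoint_estimate[OF pq, of \<alpha> "(1 - \<alpha>) * l" "a - b" b f "deriv f" "{a..b}",
        folded cb, unfolded seg_b] der assms(5,11) cs \<alpha> l
    by (simp flip: c')
  have "I_fun f l \<alpha> a b = A + B"
    unfolding I_fun_def split A_def B_def c_def[symmetric]
    by (simp add: algebra_simps add_divide_distrib)
  then have main: "\<bar>I_fun f l \<alpha> a b\<bar> \<le> C *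
      (K \<alpha> powr (1 / p) * c_fun f a b \<alpha> q powr (1 / q)
       + K (1 - \<alpha>) powr (1 / p) * k_fun f a b \<alpha> q powr (1 / q))"
    using bound_A bound_B unfolding distrib_left by linarith
  have nn: "0 \<le> \<alpha> * l" "0 \<le> (1 - \<alpha>) * l" using \<alpha> l by auto
  have e1: "K x = eps1 x l p" if "0 \<le> x * l" "x * l \<le> 1 - x" for x
    unfolding K_def using kernel_value_eq_eps1[OF that] .
  have e2: "K x = eps2 x l p" if "0 \<le> x * l" "1 - x \<le> x * l" for x
    unfolding K_def using kernel_value_eq_eps2[OF that] .
  show ?thesis
  proof (intro conjI impI; elim conjE)
    assume "\<alpha> * l \<le> 1 - \<alpha>" "1 - \<alpha> \<le> 1 - l * (1 - \<alpha>)"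
    then show "\<bar>I_fun f l \<alpha> a b\<bar> \<le> (b - a) * (1 / (p + 1)) powr (1 / p) *
        (eps1 \<alpha> l p powr (1 / p) * c_fun f a b \<alpha> q powr (1 / q)
         + eps1 (1 - \<alpha>) l p powr (1 / p) * k_fun f a b \<alpha> q powr (1 / q))"
      using main e1[of \<alpha>] e1[of "1 - \<alpha>"] nn by (simp add: C_def mult.commute[of l])
  next
    assume 2: "\<alpha> * l \<le> 1 - l * (1 - \<alpha>)" "1 - l * (1 - \<alpha>) \<le> 1 - \<alpha>"
    then have "\<alpha> * l \<le> 1 - \<alpha>" by linarith
    then show "\<bar>I_fun f l \<alpha> a b\<bar> \<le> (b - a) * (1 / (p + 1)) powr (1 / p) *
        (eps1 \<alpha> l p powr (1 / p) * c_fun f a b \<alpha> q powr (1 / q)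
         + eps2 (1 - \<alpha>) l p powr (1 / p) * k_fun f a b \<alpha> q powr (1 / q))"
      using main e1[of \<alpha>] e2[of "1 - \<alpha>"] nn 2 by (simp add: C_def mult.commute[of l])
  next
    assume 3: "1 - \<alpha> \<le> \<alpha> * l" "\<alpha> * l \<le> 1 - l * (1 - \<alpha>)"
    then have "(1 - \<alpha>) * l \<le> 1 - (1 - \<alpha>)" by (simp add: algebra_simps)
    then show "\<bar>I_fun f l \<alpha> a b\<bar> \<le> (b - a) * (1 / (p + 1)) powr (1 / p) *
        (eps2 \<alpha> l p powr (1 / p) * c_fun f a b \<alpha> q powr (1 / q)
         + eps1 (1 - \<alpha>) l p powr (1 / p) * k_fun f a b \<alpha> q powr (1 / q))"
      using main e2[of \<alpha>] e1[of "1 - \<alpha>"] nn 3 by (simp add: C_def mult.commute[of l])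
  qed
qed

end
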